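(* Let $(\sigma_k)_{k\ge1}$ be a nondecreasing sequence of positive numbers with $\lim_{k\to\infty}\sigma_k=+\infty$, let $M\ge1$, and for each $k\ge 1$ let $x^k$ be a global minimizer of $$(P_k)\quad \min_{0\le x\le M}\ f(x)+\frac{\sigma_k}{2}\sum_{i=1}^{n_1}(e^T\bar x_i-1)^2 .$$ Let $K\subseteq\{1,2,\dots\}$ be an infinite set such that $\lim_{k\to\infty,\,k\in K}x^k=z$, where $z$ is a global minimizer of $$(R)\quad \min_{x\in\mathbb R^n} f(x)\quad\text{s.t. } e^T\bar x_i=1,\ i=1,\dots,n_1,\quad x\ge 0.$$ If there exists a positive integer $k_0$ such that $\|x^k\|_0=n_1$ for all $k\ge k_0$, $k\in K$, then there is a positive integer $k_1\ge k_0$ such that $$\Gamma^k=\Gamma(z)\quad\text{for all }k\ge k_1,\ k\in K.$$ Furthermore, $z$ is a global minimizer of $$(P)\quad \min_{x\in\mathbb R^n} f(x)\quad\text{s.t. } e^T\bar x_i=1,\ i=1,\dots,n_1,\quad x\ge 0,\quad \|x\|_0\le n_1.$$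
   Context: Let $n_1\le n_2$ be positive integers and $n=n_1n_2$. A vector $x\in\mathbb R^n$ is partitioned into blocks $x=(\bar x_1^T,\dots,\bar x_{n_1}^T)^T$ with $\bar x_i\in\mathbb R^{n_2}$; $e\in\mathbb R^{n_2}$ is the all-ones vector; $\|x\|_0$ is the number of nonzero entries of $x$; inequalities between vectors (and between a vector and a scalar) are entrywise. The support set of $x$ is $\Gamma(x)=\{l: x_l>0\}$, and $\Gamma^k:=\Gamma(x^k)$. Hypergraph data: $G_1=(V_1,E_1)$, $G_2=(V_2,E_2)$ are 3-uniform hypergraphs with $V_1=\{1,\dots,n_1\}$, $V_2=\{1,\dots,n_2\}$; every hyperedge is a triple of three distinct points. The score tensor $\mathcal B\in\mathbb R^{n_1\times n_2\times n_1\times n_2\times n_1\times n_2}$ satisfies: $\mathcal B_{l_1l_2j_1j_2k_1k_2}\ge 0$ always; it is $0$ unless $(l_1,j_1,k_1)\in E_1$ and $(l_2,j_2,k_2)\in E_2$; and it is invariant under applying the same permutation to $(l_1,j_1,k_1)$ and to $(l_2,j_2,k_2)$. The tensor $\mathcal A\in\mathbb R^{n\times n\times n}$ is $\mathcal A_{ljk}=\mathcal B_{l_1l_2j_1j_2k_1k_2}$ with $l=(l_1-1)n_2+l_2$, $j=(j_1-1)n_2+j_2$, $k=(k_1-1)n_2+k_2$. (Thus $\mathcal A$ is nonnegative, symmetric, and $\mathcal A_{ljk}\ne0$ only if $l,j,k$ lie in three different blocks.) The objective is $f(x)=-\frac16\mathcal A x^3$ with $\mathcal A x^3:=\sum_{l,j,k}\mathcal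 A_{ljk}x_lx_jx_k$. *)

theory Defs
  imports "HOL-Analysis.Analysis"
begin

text \<open>The vertex sets \<open>{1,...,n\<^sub>1}\<close> and \<open>{1,...,n\<^sub>2}\<close> are the finite types \<open>'m\<close> and \<open>'n\<close>, and
  \<open>\<real>\<^sup>n\<close> with \<open>n = n\<^sub>1 n\<^sub>2\<close> is \<open>real ^ ('m \<times> 'n)\<close>: the pair \<open>(l\<^sub>1, l\<^sub>2)\<close> plays the role of the flat index
  \<open>l = (l\<^sub>1 - 1) n\<^sub>2 + l\<^sub>2\<close>, so that \<open>fst l\<close> is the block containing \<open>l\<close>.\<close>

definition block :: "real ^ ('m::finite \<times> 'n::finite) \<Rightarrow> 'm \<Rightarrow> real ^ 'n" where
  "block x i = (\<chi> j. x $ (i, j))"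

definition l0_norm :: "real ^ 'k::finite \<Rightarrow> nat" where
  "l0_norm x = card {l. x $ l \<noteq> 0}"

definition pos_support :: "real ^ 'k::finite \<Rightarrow> 'k set" where
  "pos_support x = {l. x $ l > 0}"

definition uniform3_hypergraph :: "'v set set \<Rightarrow> bool" where
  "uniform3_hypergraph E \<longleftrightarrow> (\<forall>e\<in>E. card e = 3)"

text \<open>The arguments of a score tensor are ordered \<open>l\<^sub>1 l\<^sub>2 j\<^sub>1 j\<^sub>2 k\<^sub>1 k\<^sub>2\<close>. In the symmetry condition
  the triples \<open>(l\<^sub>1, j\<^sub>1, k\<^sub>1)\<close> and \<open>(l\<^sub>2, j\<^sub>2, k\<^sub>2)\<close> are \<open>(p 1, p 2, p 3)\<close> and \<open>(q 1, q 2, q 3)\<close>.\<close>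

definition score_tensor ::
  "'m set set \<Rightarrow> 'n set set \<Rightarrow> ('m \<Rightarrow> 'n \<Rightarrow> 'm \<Rightarrow> 'n \<Rightarrow> 'm \<Rightarrow> 'n \<Rightarrow> real) \<Rightarrow> bool" where
  "score_tensor E1 E2 B \<longleftrightarrow>
     (\<forall>l1 l2 j1 j2 k1 k2. B l1 l2 j1 j2 k1 k2 \<ge> 0) \<and>
     (\<forall>l1 l2 j1 j2 k1 k2. \<not> ({l1, j1, k1} \<in> E1 \<and> {l2, j2, k2} \<in> E2) \<longrightarrow>
        B l1 l2 j1 j2 k1 k2 = 0) \<and>
     (\<forall>(p :: nat \<Rightarrow> 'm) (q :: nat \<Rightarrow> 'n) \<pi>. \<pi> permutes {1, 2, 3} \<longrightarrow>
        B (p (\<pi> 1)) (q (\<pi> 1)) (p (\<pi> 2)) (q (\<pi> 2)) (p (\<pi> 3)) (q (\<pi> 3)) =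
        B (p 1) (q 1) (p 2) (q 2) (p 3) (q 3))"

definition assoc_tensor ::
  "('m \<Rightarrow> 'n \<Rightarrow> 'm \<Rightarrow> 'n \<Rightarrow> 'm \<Rightarrow> 'n \<Rightarrow> real) \<Rightarrow>
     'm \<times> 'n \<Rightarrow> 'm \<times> 'n \<Rightarrow> 'm \<times> 'n \<Rightarrow> real" where
  "assoc_tensor B l j k = B (fst l) (snd l) (fst j) (snd j) (fst k) (snd k)"

definition cubic_form :: "('k::finite \<Rightarrow> 'k \<Rightarrow> 'k \<Rightarrow> real) \<Rightarrow> real ^ 'k \<Rightarrow> real" where
  "cubic_form A x = (\<Sum>l\<in>UNIV. \<Sum>j\<in>UNIV. \<Sum>k\<in>UNIV. A l j k * x $ l * x $ j * x $ k)"

definition objective ::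
  "('m::finite \<Rightarrow> 'n::finite \<Rightarrow> 'm \<Rightarrow> 'n \<Rightarrow> 'm \<Rightarrow> 'n \<Rightarrow> real) \<Rightarrow> real ^ ('m \<times> 'n) \<Rightarrow> real" where
  "objective B x = - (1 / 6) * cubic_form (assoc_tensor B) x"

text \<open>Below, \<open>1 :: real ^ 'n\<close> is the all-ones vector, the unit of the componentwise product.\<close>

definition penalty_objective ::
  "('m::finite \<Rightarrow> 'n::finite \<Rightarrow> 'm \<Rightarrow> 'n \<Rightarrow> 'm \<Rightarrow> 'n \<Rightarrow> real) \<Rightarrow> real \<Rightarrow> real ^ ('m \<times> 'n) \<Rightarrow> real" where
  "penalty_objective B s x =
     objective B x + s / 2 * (\<Sum>i\<in>UNIV. ((1 :: real ^ 'n) \<bullet> block x i - 1)\<^sup>2)"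

definition box_feasible :: "real \<Rightarrow> (real ^ 'k::finite) set" where
  "box_feasible M = {x. \<forall>l. 0 \<le> x $ l \<and> x $ l \<le> M}"

definition relaxed_feasible :: "(real ^ ('m::finite \<times> 'n::finite)) set" where
  "relaxed_feasible = {x. (\<forall>i. (1 :: real ^ 'n) \<bullet> block x i = 1) \<and> (\<forall>l. 0 \<le> x $ l)}"

definition sparse_feasible :: "(real ^ ('m::finite \<times> 'n::finite)) set" where
  "sparse_feasible = {x \<in> relaxed_feasible. l0_norm x \<le> CARD('m)}"

abbreviation global_minimizer :: "('a \<Rightarrow> real) \<Rightarrow> 'a set \<Rightarrow> 'a \<Rightarrow> bool" where
  "global_minimizer f S x \<equiv> is_arg_min f (\<lambda>y. y \<in> S) x"

end

theory Submission
  imports Defs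
begin

text \<open>Positive entries of \<open>z\<close> stay positive along the sequence, so \<open>\<Gamma>(z) \<subseteq> \<Gamma>\<^sup>k\<close> eventually. Every block
  of \<open>z\<close> sums to one and hence contains a positive entry, so \<open>\<Gamma>(z)\<close> has at least \<open>n\<^sub>1\<close> elements,
  while \<open>\<Gamma>\<^sup>k\<close> has at most \<open>\<parallel>x\<^sup>k\<parallel>\<^sub>0 = n\<^sub>1\<close>; so the two sets coincide. In particular
  \<open>z\<close> has \<open>n\<^sub>1\<close> nonzero entries, and a minimizer of the relaxed problem that is feasible for the
  sparse one solves it.\<close>

lemma global_minimizer_subset:
  assumes "global_minimizer f S z" and "T \<subseteq> S" and "z \<in> T"
  shows "global_minimizer f T z"
  using assms by (auto simp: is_arg_min_def)

lemma card_pos_support_le_l0_norm: "card (pos_support x) \<le> l0_norm x"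
  unfolding pos_support_def l0_norm_def by (rule card_mono) auto

lemma l0_norm_nonneg:
  assumes "\<And>l. 0 \<le> x $ l"
  shows "l0_norm x = card (pos_support x)"
  using assms unfolding pos_support_def l0_norm_def
  by (metis (no_types, lifting) less_le order_less_irrefl)

text \<open>Strict positivity of a coordinate is an open condition, and there are only finitely many
  coordinates. Only this inclusion can be expected: an entry may be positive along the sequence and
  vanish in the limit.\<close>

lemma eventually_pos_support_subset:
  assumes "(x \<longlongrightarrow> z) F"
  shows "eventually (\<lambda>k. pos_support z \<subseteq> pos_support (x k)) F"
proof -
  have "eventually (\<lambda>k. 0 < z $ l \<longrightarrow> 0 < x k $ l) F" for l
  proof (cases "0 < z $ l")
    case True
    then show ?thesis
      using order_tendstoD(1)[OF tendsto_vec_nth[OF assms]] by simp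
  qed simp
  then have "eventually (\<lambda>k. \<forall>l. 0 < z $ l \<longrightarrow> 0 < x k $ l) F"
    by (rule eventually_all_finite)
  then show ?thesis
    by (auto simp: pos_support_def elim: eventually_mono)
qed

lemma relaxed_feasible_card_pos_support:
  fixes z :: "real ^ ('m::finite \<times> 'n::finite)"
  assumes "z \<in> relaxed_feasible"
  shows "CARD('m) \<le> card (pos_support z)"
proof -
  \<comment> \<open>Each block index is hit, so \<open>fst\<close> maps the support onto
    \<open>'m\<close>, and an image is no larger than its source.\<close>
  have "i \<in> fst ` pos_support z" for i
  proof -
    have "(\<Sum>j\<in>UNIV. z $ (i, j)) = 1"
      using assms by (simp add: relaxed_feasible_def block_def inner_vec_def)
    then obtain j where "0 < z $ (i, j)"
      by (metis sum_nonpos not_one_le_zero not_less)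
    then show ?thesis
      by (force simp: pos_support_def)
  qed
  then have "fst ` pos_support z = UNIV"
    by auto
  then show ?thesis
    by (metis card_image_le finite)
qed

theorem theorem3:
  fixes E1 :: "'m::finite set set" and E2 :: "'n::finite set set"
    and B :: "'m \<Rightarrow> 'n \<Rightarrow> 'm \<Rightarrow> 'n \<Rightarrow> 'm \<Rightarrow> 'n \<Rightarrow> real"
    and \<sigma> :: "nat \<Rightarrow> real" and M :: real
    and x :: "nat \<Rightarrow> real ^ ('m \<times> 'n)" and z :: "real ^ ('m \<times> 'n)"
    and K :: "nat set" and k0 :: nat
  assumes "CARD('m) \<le> CARD('n)"
    and "uniform3_hypergraph E1" and "uniform3_hypergraph E2"
    and "score_tensor E1 E2 B"
    and "mono_on {1..} \<sigma>" and "\<And>k. k \<ge> 1 \<Longrightarrow> \<sigma> k > 0"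
    and "filterlim \<sigma> at_top sequentially"
    and "M \<ge> 1"
    and "\<And>k. k \<ge> 1 \<Longrightarrow> global_minimizer (penalty_objective B (\<sigma> k)) (box_feasible M) (x k)"
    and "K \<subseteq> {1..}" and "infinite K"
    and "(x \<longlongrightarrow> z) (inf sequentially (principal K))"
    and "global_minimizer (objective B) relaxed_feasible z"
    and "k0 \<ge> 1" and "\<And>k. k \<in> K \<Longrightarrow> k \<ge> k0 \<Longrightarrow> l0_norm (x k) = CARD('m)"
  shows "(\<exists>k1\<ge>k0. \<forall>k\<in>K. k \<ge> k1 \<longrightarrow> pos_support (x k) = pos_support z) \<and>
         global_minimizer (objective B) sparse_feasible z"
proof -
  have z: "z \<in> relaxed_feasible"
    using assms(13) by (simp add: is_arg_min_def)
  obtain k2 where k2: "\<And>k. k \<in> K \<Longrightarrow> k \<ge> k2 \<Longrightarrow> pos_support z \<subseteq> pos_support (x k)"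
    using eventually_pos_support_subset[OF assms(12)]
    by (auto simp: eventually_inf_principal eventually_sequentially)
  \<comment> \<open>Beyond \<open>k2\<close> the inclusion holds, beyond \<open>k0\<close> the count
    of nonzero entries; the maximum serves as the required \<open>k1\<close>.\<close>
  have eq: "pos_support (x k) = pos_support z" if "k \<in> K" "k \<ge> max k0 k2" for k
  proof -
    have "card (pos_support (x k)) \<le> card (pos_support z)"
      using card_pos_support_le_l0_norm[of "x k"] assms(15)[of k] that
        relaxed_feasible_card_pos_support[OF z] by simp
    then show ?thesis
      using card_seteq[OF _ k2[OF that(1)]] that(2) by simp
  qed
  \<comment> \<open>A single late index, available since \<open>K\<close> is infinite, carries the
    sparsity bound over to \<open>z\<close>.\<close>
  obtain k where k: "k \<in> K" "k \<ge> max k0 k2"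
    using \<open>infinite K\<close> by (meson infinite_nat_iff_unbounded_le)
  have "l0_norm z = card (pos_support (x k))"
    using z eq[OF k] l0_norm_nonneg[of z] by (auto simp: relaxed_feasible_def)
  also have "\<dots> \<le> CARD('m)"
    using card_pos_support_le_l0_norm[of "x k"] assms(15)[of k] k by simp
  finally have "z \<in> sparse_feasible"
    using z by (simp add: sparse_feasible_def)
  moreover have "sparse_feasible \<subseteq> (relaxed_feasible :: (real ^ ('m \<times> 'n)) set)"
    by (auto simp: sparse_feasible_def)
  ultimately have "global_minimizer (objective B) sparse_feasible z"
    using global_minimizer_subset[OF assms(13)] by blast
  then show ?thesis
    using eq by (meson max.cobounded1)
qed

end
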